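(* Let $A$, $B$ be positive integers such that $\min\{A,B\}>1$, $\gcd(A,B)=1$ and $AB\equiv 0 \pmod 2$, and let $n$ be a positive integer with $n>1$. If $A>8B^3$, then the equation $$(A^2 n)^x + (B^2 n)^y = ((A^2+B^2)n)^z$$ has no solutions in positive integers $x,y,z$ with $x>z>y$. *)

theory Defs
  imports "HOL-Number_Theory.Number_Theory"
begin

end

theory Submission
  imports Defs "HOL-Analysis.Harmonic_Numbers" "HOL-Computational_Algebra.Squarefree"
    "HOL-Computational_Algebra.Nth_Powers"
begin

text \<open>
  Put \<open>C = A\<^sup>2 + B\<^sup>2\<close>. Dividing out the powers of \<open>n\<close>, whose prime factors all divide \<open>B\<close>, turns the
  equation into \<open>V\<^sup>2 + D U\<^sup>2 = C ^ z\<close> with \<open>A ^ x\<close> dividing \<open>U\<close> and \<open>D \<le> B\<close>. In the order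
  $\mathbb{Z}[\sqrt{-D}]$ the element \<open>\<alpha> = V + U\<close>$\sqrt{-D}$ is, up to a unit, a power \<open>\<gamma> ^ q\<close> of an
  element \<open>\<gamma>\<close> of norm \<open>C ^ h\<close>, where \<open>z = h q\<close>, and counting reduced forms gives \<open>h \<le> 3 D\<close>.
  Some \<open>\<gamma> ^ r\<close> with \<open>r \<le> \<sigma>(A)\<close> has an imaginary part \<open>v\<close> divisible by \<open>A\<close>, and lifting the
  exponent shows that \<open>A ^ x\<close> divides \<open>2 q v\<close>. Since \<open>v\<^sup>2 \<le> C ^ (h r)\<close>, this bounds \<open>z\<close> by roughly
  \<open>h r\<close>, that is by \<open>O(A B ln A)\<close>. On the other hand \<open>(1 + B\<^sup>2 / A\<^sup>2) ^ z \<ge> A\<^sup>2\<close> forces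
  \<open>z \<ge> 2 A\<^sup>2 ln A / B\<^sup>2\<close>, which is larger when \<open>A > 8 B\<^sup>3\<close>.
\<close>

lemma dvd_if_prime_powers_dvd:
  fixes a b :: int
  assumes "a \<noteq> 0" "\<And>p k. prime p \<Longrightarrow> p ^ k dvd a \<Longrightarrow> p ^ k dvd b"
  shows "a dvd b"
proof (cases "b = 0")
  case False
  show ?thesis
  proof (rule multiplicity_le_imp_dvd)
    fix p :: int assume p: "prime p"
    have "p ^ multiplicity p a dvd b"
      by (intro assms(2) p multiplicity_dvd)
    then show "multiplicity p a \<le> multiplicity p b"
      using p False by (intro multiplicity_geI) (auto simp: not_prime_unit)
  qed (use assms(1) in simp)
qed simp

section \<open>Imaginary quadratic orders\<close>

locale quadratic_order =
  fixes D :: nat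
  assumes D_pos: "D > 0"
begin

definition \<omega> :: complex where "\<omega> = Complex 0 (sqrt D)"

definition elt :: "int \<Rightarrow> int \<Rightarrow> complex" where "elt a b = of_int a + of_int b * \<omega>"

text \<open>The order Z[sqrt(-D)], not necessarily maximal. Embedding it in the complex numbers
  makes quotients and conjugates of its elements available at once.\<close>

definition R :: "complex set" where "R = {elt a b |a b. True}"

text \<open>The quotient must lie in \<open>R\<close>, since \<open>dvd\<close> on the field of
  complex numbers says next to nothing.\<close>

definition divides :: "int \<Rightarrow> complex \<Rightarrow> bool" where
  "divides m \<xi> \<longleftrightarrow> (\<exists>\<eta>\<in>R. \<xi> = of_int m * \<eta>)"

lemma omega_square: "\<omega> * \<omega> = - of_nat D"
  by (simp add: \<omega>_def complex_eq_iff)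

lemma cnj_omega: "cnj \<omega> = - \<omega>"
  by (simp add: \<omega>_def complex_eq_iff)

lemma elt_eq_iff: "elt a b = elt c d \<longleftrightarrow> a = c \<and> b = d"
  using D_pos by (auto simp: elt_def \<omega>_def complex_eq_iff)

lemma elt_mult: "elt a b * elt c d = elt (a * c - int D * b * d) (a * d + b * c)"
proof -
  have "elt a b * elt c d = of_int (a * c) + of_int (a * d + b * c) * \<omega> + of_int (b * d) * (\<omega> * \<omega>)"
    by (simp add: elt_def algebra_simps)
  then show ?thesis
    unfolding omega_square by (simp add: elt_def algebra_simps)
qed

lemma elt_add: "elt a b + elt c d = elt (a + c) (b + d)"
  by (simp add: elt_def algebra_simps)

lemma cnj_elt: "cnj (elt a b) = elt a (- b)"
  by (simp add: elt_def cnj_omega)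

lemma of_int_eq_elt: "of_int a = elt a 0"
  by (simp add: elt_def)

lemma elt_norm: "elt a b * cnj (elt a b) = of_int (a\<^sup>2 + int D * b\<^sup>2)"
  unfolding cnj_elt elt_mult of_int_eq_elt elt_eq_iff by (simp add: power2_eq_square)

lemma elt_in_R [intro, simp]: "elt a b \<in> R"
  by (auto simp: R_def)

lemma R_cases: "\<xi> \<in> R \<Longrightarrow> (\<And>a b. \<xi> = elt a b \<Longrightarrow> P) \<Longrightarrow> P"
  by (auto simp: R_def)

lemma R_of_int [intro, simp]: "of_int a \<in> R"
  by (simp add: of_int_eq_elt)

lemma R_1 [intro, simp]: "1 \<in> R"
  using R_of_int[of 1] by simp

lemma R_add [intro]: "\<xi> \<in> R \<Longrightarrow> \<eta> \<in> R \<Longrightarrow> \<xi> + \<eta> \<in> R"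
  by (auto elim!: R_cases simp: elt_add)

lemma R_mult [intro]: "\<xi> \<in> R \<Longrightarrow> \<eta> \<in> R \<Longrightarrow> \<xi> * \<eta> \<in> R"
  by (auto elim!: R_cases simp: elt_mult)

lemma R_cnj [intro]: "\<xi> \<in> R \<Longrightarrow> cnj \<xi> \<in> R"
  by (auto elim!: R_cases simp: cnj_elt)

lemma R_power [intro]: "\<xi> \<in> R \<Longrightarrow> \<xi> ^ k \<in> R"
  by (induction k) auto

lemma divides_add: "divides m \<xi> \<Longrightarrow> divides m \<eta> \<Longrightarrow> divides m (\<xi> + \<eta>)"
  unfolding divides_def by (metis R_add distrib_left)

lemma divides_mult_right: "divides m \<xi> \<Longrightarrow> \<eta> \<in> R \<Longrightarrow> divides m (\<xi> * \<eta>)"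
  unfolding divides_def by (metis R_mult mult.assoc)

lemma divides_mult_left: "divides m \<xi> \<Longrightarrow> \<eta> \<in> R \<Longrightarrow> divides m (\<eta> * \<xi>)"
  unfolding mult.commute[of \<eta>] by (rule divides_mult_right)

lemma divides_cnj: "divides m \<xi> \<Longrightarrow> divides m (cnj \<xi>)"
  unfolding divides_def by (metis R_cnj complex_cnj_mult complex_cnj_of_int)

lemma divides_trans: "k dvd m \<Longrightarrow> divides m \<xi> \<Longrightarrow> divides k \<xi>"
  unfolding divides_def by (elim dvdE bexE) (metis R_mult R_of_int mult.assoc of_int_mult)

lemma divides_elt_iff: "divides m (elt a b) \<longleftrightarrow> m dvd a \<and> m dvd b"
proof
  assume "divides m (elt a b)"
  then obtain c d where "elt a b = of_int m * elt c d"
    unfolding divides_def by (metis R_cases)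
  then show "m dvd a \<and> m dvd b"
    by (simp add: of_int_eq_elt elt_mult elt_eq_iff)
next
  assume "m dvd a \<and> m dvd b"
  then obtain c d where "a = m * c" "b = m * d" by (auto elim!: dvdE)
  then have "elt a b = of_int m * elt c d"
    by (simp add: of_int_eq_elt elt_mult elt_eq_iff)
  then show "divides m (elt a b)"
    unfolding divides_def by blast
qed

lemma divides_coprime_cancel:
  assumes "divides m (of_int k * \<xi>)" "coprime k m" "\<xi> \<in> R"
  shows "divides m \<xi>"
proof -
  obtain x y where xy: "x * k + y * m = 1"
    using assms(2) bezout_int[of k m] by (metis coprime_imp_gcd_eq_1)
  have "\<xi> = of_int (x * k + y * m) * \<xi>"
    by (simp add: xy)
  also have "\<dots> = of_int x * (of_int k * \<xi>) + of_int m * (of_int y * \<xi>)"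
    by (simp add: algebra_simps)
  finally have "\<xi> = \<dots>" .
  moreover have "divides m (of_int m * (of_int y * \<xi>))"
    unfolding divides_def using assms(3) by blast
  ultimately show ?thesis
    using divides_add divides_mult_left[OF assms(1), of "of_int x"] by (metis R_of_int)
qed

text \<open>An element of norm 1 is 1 or -1, or for D = 1 possibly i or -i. Squaring leaves only a
  sign to carry along.\<close>

lemma norm_1_square:
  assumes "\<xi> \<in> R" "\<xi> * cnj \<xi> = 1"
  shows "\<xi>\<^sup>2 = 1 \<or> \<xi>\<^sup>2 = - 1"
proof -
  obtain a b where ab: "\<xi> = elt a b" using assms(1) by (rule R_cases)
  have "complex_of_int (a\<^sup>2 + int D * b\<^sup>2) = of_int 1"
    using assms(2) unfolding ab elt_norm by simp
  then have 1: "a\<^sup>2 + int D * b\<^sup>2 = 1"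
    using of_int_eq_iff by blast
  show ?thesis
  proof (cases "b = 0")
    case True
    then show ?thesis using 1 ab by (auto simp: elt_def power2_eq_1_iff)
  next
    case False
    then have "b\<^sup>2 \<ge> 1" by (simp add: int_one_le_iff_zero_less)
    moreover have "int D * b\<^sup>2 \<ge> b\<^sup>2" using D_pos by (simp add: mult_le_cancel_right1)
    moreover have "a\<^sup>2 \<ge> 0" by simp
    ultimately have *: "a = 0" "int D * b\<^sup>2 = 1" using 1
      by (smt (verit) power2_eq_iff_nonneg zero_power2 zero_le_power2 power_eq_0_iff)+
    have "\<xi>\<^sup>2 = of_int (b\<^sup>2) * (\<omega> * \<omega>)"
      by (simp add: ab elt_def * power2_eq_square mult_ac)
    also have "\<dots> = - of_int (int D * b\<^sup>2)"
      unfolding omega_square by simp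
    finally show ?thesis using * by simp
  qed
qed

section \<open>Lifting the exponent for imaginary parts of powers\<close>

text \<open>The binomial theorem sorted by powers of \<open>v\<close>, even ones going to the real
  part and odd ones to the imaginary part. Only the lowest terms matter later, so the rest stays
  anonymous in \<open>J\<close> and \<open>K\<close>.\<close>

lemma elt_power_expansion:
  "\<exists>J K. elt u v ^ m = elt (u ^ m + v\<^sup>2 * J) (int m * u ^ (m - 1) * v + v ^ 3 * K)"
proof (induction m)
  case 0
  have "elt u v ^ 0 = elt (u ^ 0 + v\<^sup>2 * 0) (int 0 * u ^ (0 - 1) * v + v ^ 3 * 0)"
    by (simp add: elt_def)
  then show ?case by blast
next
  case (Suc m)
  then obtain J K where IH: "elt u v ^ m = elt (u ^ m + v\<^sup>2 * J) (int m * u ^ (m - 1) * v + v ^ 3 * K)"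
    by blast
  have u: "int m * (u ^ (m - 1) * u) = int m * u ^ m"
    by (cases m) simp_all
  have re: "(u ^ m + v\<^sup>2 * J) * u - int D * (int m * u ^ (m - 1) * v + v ^ 3 * K) * v =
    u ^ Suc m + v\<^sup>2 * (J * u - int D * (int m * u ^ (m - 1) + v\<^sup>2 * K))"
    by (simp add: algebra_simps power2_eq_square power3_eq_cube)
  have "(u ^ m + v\<^sup>2 * J) * v + (int m * u ^ (m - 1) * v + v ^ 3 * K) * u =
    u ^ m * v + (int m * (u ^ (m - 1) * u)) * v + v ^ 3 * (J + K * u)"
    by (simp add: algebra_simps power2_eq_square power3_eq_cube)
  also have "\<dots> = int (Suc m) * u ^ (Suc m - 1) * v + v ^ 3 * (J + K * u)"
    unfolding u by (simp add: algebra_simps)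
  finally show ?case
    unfolding power_Suc2 IH elt_mult re by metis
qed

text \<open>If \<open>p\<close> does not divide \<open>m\<close>, the imaginary part is
  \<open>v\<close> times a number prime to \<open>p\<close>. Otherwise, passing from exponent m/p to
  \<open>m\<close> multiplies the imaginary part by \<open>p\<close> and a number prime to
  \<open>p\<close>, so induction applies.\<close>

lemma prime_power_dvd_im_power:
  assumes p: "prime p" "p dvd v" "\<not> p dvd u"
  shows "elt u v ^ m = elt a b \<Longrightarrow> p ^ k dvd b \<Longrightarrow> p ^ k dvd int m * v"
proof (induction m arbitrary: a b k rule: less_induct)
  case (less m)
  obtain J K where JK: "elt u v ^ m = elt (u ^ m + v\<^sup>2 * J) (int m * u ^ (m - 1) * v + v ^ 3 * K)"
    using elt_power_expansion by blast
  consider "m = 0" | "\<not> p dvd int m" | "m > 0" "p dvd int m" by auto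
  then show ?case
  proof cases
    case 2
    have "b = v * (int m * u ^ (m - 1) + v * (v * K))"
      using JK less.prems(1) by (simp add: elt_eq_iff algebra_simps power3_eq_cube)
    moreover have "\<not> p dvd int m * u ^ (m - 1) + v * (v * K)"
      using 2 p by (metis dvd_add_left_iff dvd_mult2 prime_dvd_mult_iff prime_dvd_power)
    then have "coprime (p ^ k) (int m * u ^ (m - 1) + v * (v * K))"
      using p(1) by (simp add: prime_imp_coprime)
    ultimately have "p ^ k dvd v"
      using less.prems(2) by (simp add: coprime_dvd_mult_left_iff)
    then show ?thesis by simp
  next
    case 3
    define m' where "m' = m div nat p"
    have p0: "p > 0" using p(1) by (simp add: prime_gt_0_int)
    have "nat p dvd m" using 3 p0 by (metis int_nat_eq of_nat_dvd_iff order_less_imp_le)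
    then have m: "m = m' * nat p" by (simp add: m'_def)
    have "nat p > 1" using p(1) prime_gt_1_int by auto
    then have m'_less: "m' < m" using 3(1) m by simp
    obtain J K where JK: "elt u v ^ m' = elt (u ^ m' + v\<^sup>2 * J) (int m' * u ^ (m' - 1) * v + v ^ 3 * K)"
      using elt_power_expansion by blast
    define a' b' where "a' = u ^ m' + v\<^sup>2 * J" and "b' = int m' * u ^ (m' - 1) * v + v ^ 3 * K"
    have a': "\<not> p dvd a'"
      unfolding a'_def using p
      by (metis dvd_add_left_iff dvd_mult2 power2_eq_square prime_dvd_power)
    have b': "p dvd b'"
      unfolding b'_def using p(2) by (simp add: power3_eq_cube)
    obtain J' K' where "elt a' b' ^ nat p =
        elt (a' ^ nat p + b'\<^sup>2 * J') (int (nat p) * a' ^ (nat p - 1) * b' + b' ^ 3 * K')"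
      using elt_power_expansion by blast
    moreover have "elt a' b' ^ nat p = elt a b"
      using less.prems(1) JK unfolding m power_mult a'_def b'_def by simp
    ultimately have b: "b = p * a' ^ (nat p - 1) * b' + b' ^ 3 * K'"
      using p0 by (simp add: elt_eq_iff)
    obtain c where c: "b' = p * c" using b' ..
    \<comment> \<open>Since \<open>b' = p * c\<close>, the cubic term has one factor
      \<open>p\<close> more than \<open>p * b'\<close>. So \<open>t\<close> is congruent modulo
      \<open>p\<close> to a power of \<open>a'\<close>, and this holds for p = 2 as well.\<close>
    define t where "t = a' ^ (nat p - 1) + p * (c * c * K')"
    have "b = (p * b') * t"
      unfolding b t_def by (simp add: c algebra_simps power3_eq_cube)
    moreover have "\<not> p dvd t"
      unfolding t_def using a' p(1) by (metis dvd_add_left_iff dvd_triv_left prime_dvd_power)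
    then have "coprime (p ^ k) t"
      using p(1) by (simp add: prime_imp_coprime)
    ultimately have *: "p ^ k dvd p * b'"
      using less.prems(2) by (simp add: coprime_dvd_mult_left_iff)
    show ?thesis
    proof (cases k)
      case (Suc k')
      then have "p ^ k' dvd b'" using * p0 by simp
      then have "p ^ k' dvd int m' * v"
        using less.IH[OF m'_less] JK unfolding a'_def b'_def by blast
      then show ?thesis
        using p0 by (simp add: Suc m mult_ac)
    qed simp
  qed simp
qed

lemma power_dvd_im_power:
  assumes "A dvd v" "coprime u A" "A \<noteq> 0" "elt u v ^ m = elt a b" "A ^ x dvd b"
  shows "A ^ x dvd int m * v"
proof (rule dvd_if_prime_powers_dvd)
  fix p k assume p: "prime p" and dvd: "p ^ k dvd A ^ x"
  show "p ^ k dvd int m * v"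
  proof (cases "k = 0")
    case False
    then have "p dvd A ^ x" using dvd by (meson dvd_power dvd_trans neq0_conv)
    then have "p dvd A" using p by (rule prime_dvd_power[rotated])
    moreover from this have "\<not> p dvd u"
      using assms(2) p by (meson coprime_common_divisor not_prime_unit)
    ultimately show ?thesis
      using prime_power_dvd_im_power[OF p _ _ assms(4)] assms(1,5) dvd by (meson dvd_trans)
  qed simp
qed (use assms(3) in simp)

section \<open>A power of an element with imaginary part divisible by \<open>A\<close>\<close>

text \<open>Pigeonhole on the powers of \<open>\<gamma>\<close>, sorted by the ratio of their
  coordinates modulo \<open>A\<close>. Two powers with the same ratio have a quotient whose
  imaginary part is divisible by \<open>A\<close>, as the norm is prime to \<open>A\<close>.\<close>

lemma rank_exists:
  fixes A :: nat
  assumes \<gamma>: "\<gamma> \<in> R" "\<gamma> * cnj \<gamma> = of_int N" and A: "A > 0" and cop: "coprime N (int A)"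
  shows "\<exists>r u v. 0 < r \<and> r \<le> (\<Sum>g | g dvd A. A div g) \<and> \<gamma> ^ r = elt u v \<and> int A dvd v"
proof -
  have "\<forall>j. \<exists>u v. \<gamma> ^ j = elt u v"
    using \<gamma>(1) R_cases R_power by metis
  then obtain u v where uv: "\<And>j. \<gamma> ^ j = elt (u j) (v j)" by metis
  \<comment> \<open>A label (g, \<rho>) stands for g = gcd(v j, A) and for the quotient \<rho> of
    \<open>u j\<close> by v j / g modulo A / g. There are \<sigma>(A) labels.\<close>
  define S where "S = (SIGMA g:{g. g dvd A}. {0..<A div g})"
  have "\<exists>p\<in>S. int (fst p) dvd v j \<and>
      [u j = int (snd p) * (v j div int (fst p))] (mod int (A div fst p))" for j
  proof -
    define g where "g = nat (gcd (v j) (int A))"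
    have g: "int g = gcd (v j) (int A)" by (simp add: g_def)
    have gv: "int g dvd v j" and "int g dvd int A" unfolding g by simp_all
    then have gA: "g dvd A" by simp
    have g0: "g > 0" using gA A by (auto intro: Nat.gr0I)
    have "coprime (v j div int g) (int A div int g)"
      unfolding g using A by (intro div_gcd_coprime) auto
    then have "coprime (v j div int g) (int (A div g))"
      by (simp add: zdiv_int)
    then obtain c where c: "[v j div int g * c = 1] (mod int (A div g))"
      using cong_solve_coprime_int by blast
    define \<rho> where "\<rho> = nat ((u j * c) mod int (A div g))"
    have m0: "A div g > 0" using gA A by (metis dvd_div_eq_0_iff gr0I less_irrefl)
    have \<rho>: "int \<rho> = (u j * c) mod int (A div g)" using m0 by (simp add: \<rho>_def)
    then have "\<rho> < A div g"
      using m0 by (metis of_nat_0_less_iff of_nat_less_iff pos_mod_bound)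
    have "[u j * (v j div int g * c) = u j * 1] (mod int (A div g))"
      using c by (rule cong_scalar_left)
    then have "[u j = (u j * c) * (v j div int g)] (mod int (A div g))"
      by (simp add: cong_sym_eq mult_ac)
    moreover have "[u j * c = int \<rho>] (mod int (A div g))"
      unfolding \<rho> by (simp add: cong_def)
    ultimately have "[u j = int \<rho> * (v j div int g)] (mod int (A div g))"
      using cong_scalar_right cong_trans by blast
    with \<open>\<rho> < A div g\<close> show ?thesis
      using gA gv by (intro bexI[of _ "(g, \<rho>)"]) (auto simp: S_def)
  qed
  then obtain f where f: "\<And>j. f j \<in> S" "\<And>j. int (fst (f j)) dvd v j"
      "\<And>j. [u j = int (snd (f j)) * (v j div int (fst (f j)))] (mod int (A div fst (f j)))"
    by metis
  have fin: "finite {g. g dvd A}" using A by simp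
  have "finite S" unfolding S_def using fin by auto
  moreover have cardS: "card S = (\<Sum>g | g dvd A. A div g)"
    unfolding S_def using fin by simp
  ultimately have "card (f ` {..card S}) \<le> card S"
    using f(1) by (intro card_mono) auto
  \<comment> \<open>The indices start at 0, so there are \<open>card S + 1\<close> of them and a
    collision has difference at most \<open>card S\<close>.\<close>
  then have "\<not> inj_on f {..card S}"
    by (intro pigeonhole) simp
  then obtain i j where ij: "i < j" "j \<le> card S" "f i = f j"
    unfolding inj_on_def by (metis atMost_iff linorder_neqE_nat)
  obtain g \<rho> where g\<rho>: "f i = (g, \<rho>)" by fastforce
  have gA: "g dvd A" using f(1)[of i] by (auto simp: g\<rho> S_def)
  obtain a where a: "v i = int g * a" using f(2)[of i] unfolding g\<rho> by auto
  obtain b where b: "v j = int g * b" using f(2)[of j] unfolding ij(3)[symmetric] g\<rho> by auto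
  have g0: "g > 0" using gA A by (auto intro: Nat.gr0I)
  have 1: "int (A div g) dvd u i - int \<rho> * a"
    using f(3)[of i] g0 unfolding g\<rho> a by (simp add: cong_iff_dvd_diff)
  have 2: "int (A div g) dvd u j - int \<rho> * b"
    using f(3)[of j] g0 unfolding ij(3)[symmetric] g\<rho> b by (simp add: cong_iff_dvd_diff)
  have "u i * b - u j * a = (u i - int \<rho> * a) * b - (u j - int \<rho> * b) * a"
    by (simp add: algebra_simps)
  then have "int (A div g) dvd u i * b - u j * a"
    using 1 2 by (simp add: dvd_diff)
  then have "int g * int (A div g) dvd int g * (u i * b - u j * a)"
    by (rule mult_dvd_mono[OF dvd_refl])
  moreover have "int g * int (A div g) = int A"
    using gA by (metis dvd_mult_div_cancel of_nat_mult)
  ultimately have dvd: "int A dvd u i * v j - u j * v i"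
    unfolding a b by (simp add: algebra_simps)
  \<comment> \<open>The imaginary part of this product is the determinant just shown to be divisible
    by \<open>A\<close>. The right-hand side exhibits it as
    \<open>v (j - i) * N ^ i\<close>.\<close>
  have "elt (u j) (v j) * cnj (elt (u i) (v i)) = \<gamma> ^ (j - i) * (\<gamma> * cnj \<gamma>) ^ i"
    using ij(1) unfolding uv[symmetric]
    by (simp add: power_mult_distrib mult.assoc[symmetric] flip: power_add)
  also have "\<dots> = elt (u (j - i)) (v (j - i)) * elt (N ^ i) 0"
    unfolding \<gamma>(2) uv by (simp add: elt_def)
  finally have "u i * v j - u j * v i = v (j - i) * N ^ i"
    unfolding cnj_elt elt_mult elt_eq_iff by (simp add: algebra_simps)
  then have "int A dvd v (j - i)"
    using dvd cop by (simp add: coprime_dvd_mult_left_iff coprime_commute)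
  then show ?thesis
    using ij uv cardS by (intro exI[of _ "j - i"]) auto
qed

end

section \<open>Primitive representations of a power by $V^2 + D U^2$\<close>

text \<open>The coprimality conditions and the odd \<open>C\<close> make \<open>U\<close> and
  \<open>2 * V\<close> invertible modulo every power of \<open>C\<close>. This stands in for unique
  factorization of ideals.\<close>

locale primitive_norm_equation = quadratic_order +
  fixes U V C :: int and z :: nat
  assumes norm_eq: "V\<^sup>2 + int D * U\<^sup>2 = C ^ z"
    and C_odd: "odd C" and C_gt_1: "C > 1"
    and coprime_V: "coprime V C" and coprime_U: "coprime U C"
begin

definition \<alpha> :: complex where "\<alpha> = elt V U"

text \<open>
  \<open>L s\<close> is the \<open>s\<close>-th power of the ideal of norm \<open>C\<close> above \<open>C\<close> that divides \<open>\<alpha>\<close>.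
  Expressing it through \<open>\<alpha>\<close> avoids ideal arithmetic, and is correct only for \<open>s \<le> z\<close>.
\<close>

definition L :: "nat \<Rightarrow> complex set" where
  "L s = {\<xi> \<in> R. divides (C ^ s) (\<xi> * cnj \<alpha>)}"

lemma \<alpha>_in_R: "\<alpha> \<in> R"
  by (simp add: \<alpha>_def)

lemma \<alpha>_norm: "\<alpha> * cnj \<alpha> = of_int (C ^ z)"
  unfolding \<alpha>_def elt_norm norm_eq ..

lemma \<alpha>_trace: "\<alpha> + cnj \<alpha> = of_int (2 * V)"
  unfolding \<alpha>_def cnj_elt elt_add of_int_eq_elt by simp

lemma \<alpha>_in_L: "s \<le> z \<Longrightarrow> \<alpha> \<in> L s"
  unfolding L_def using \<alpha>_in_R \<alpha>_norm
  by (auto simp: of_int_eq_elt divides_elt_iff le_imp_power_dvd simp del: of_int_power)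

text \<open>The sum of \<open>\<alpha>\<close> and its conjugate is \<open>2 * V\<close>, a unit
  modulo \<open>C ^ s\<close>, so the two have no common factor above \<open>C\<close>.\<close>

lemma divides_of_trace:
  assumes "\<xi> \<in> R" "divides (C ^ s) (\<xi> * \<alpha>)" "divides (C ^ s) (\<xi> * cnj \<alpha>)"
  shows "divides (C ^ s) \<xi>"
proof (rule divides_coprime_cancel[of _ "2 * V"])
  have "of_int (2 * V) * \<xi> = \<xi> * \<alpha> + \<xi> * cnj \<alpha>"
    unfolding \<alpha>_trace[symmetric] by (simp add: algebra_simps)
  then show "divides (C ^ s) (of_int (2 * V) * \<xi>)"
    using assms divides_add by presburger
  show "coprime (2 * V) (C ^ s)"
    using coprime_V C_odd by simp
qed (use assms in auto)

lemma L_in_R: "\<xi> \<in> L s \<Longrightarrow> \<xi> \<in> R"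
  by (simp add: L_def)

lemma L_add: "\<xi> \<in> L s \<Longrightarrow> \<eta> \<in> L s \<Longrightarrow> \<xi> + \<eta> \<in> L s"
  by (auto simp: L_def ring_distribs intro: divides_add)

lemma L_mult: "\<xi> \<in> L s \<Longrightarrow> \<eta> \<in> R \<Longrightarrow> \<eta> * \<xi> \<in> L s"
  by (auto simp: L_def mult.assoc intro: divides_mult_left)

lemma L_mono: "s \<le> s' \<Longrightarrow> \<xi> \<in> L s' \<Longrightarrow> \<xi> \<in> L s"
  unfolding L_def using divides_trans le_imp_power_dvd by blast

text \<open>After multiplication by \<open>U\<close>, the norm equation reduces the condition on the
  real part to that on the imaginary part. Hence a single linear congruence cuts out
  \<open>L s\<close>.\<close>

lemma elt_in_L_iff: 
  assumes "s \<le> z"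
  shows "elt a b \<in> L s \<longleftrightarrow> C ^ s dvd b * V - a * U"
proof -
  have "elt a b * cnj \<alpha> = elt (a * V + int D * b * U) (b * V - a * U)"
    by (simp add: \<alpha>_def cnj_elt elt_mult)
  then have "elt a b \<in> L s \<longleftrightarrow> C ^ s dvd a * V + int D * b * U \<and> C ^ s dvd b * V - a * U"
    by (simp add: L_def divides_elt_iff)
  moreover have "C ^ s dvd a * V + int D * b * U" if "C ^ s dvd b * V - a * U"
  proof -
    have "U * (a * V + int D * b * U) = b * C ^ z - V * (b * V - a * U)"
      unfolding norm_eq[symmetric] by (simp add: algebra_simps power2_eq_square)
    moreover have "C ^ s dvd C ^ z" using assms by (rule le_imp_power_dvd)
    ultimately have "C ^ s dvd U * (a * V + int D * b * U)"
      using that by (metis dvd_diff dvd_mult)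
    then show ?thesis
      using coprime_U by (simp add: coprime_dvd_mult_right_iff coprime_commute)
  qed
  ultimately show ?thesis by blast
qed

section \<open>Reduction of the norm forms\<close>

text \<open>For a form of discriminant -4D, so with \<open>a * c = b\<^sup>2 + D\<close>, the usual
  conditions 2|b| \<le> a \<le> c imply these. The last inequality replaces a \<le> c and bounds
  \<open>a\<close> without mentioning \<open>c\<close>.\<close>

definition reduced_pairs :: "(int \<times> int) set" where
  "reduced_pairs = {(a, b). 0 < a \<and> 2 * \<bar>b\<bar> \<le> a \<and> 3 * a\<^sup>2 \<le> 4 * int D}"

text \<open>
  The norm form of the basis is \<open>C ^ s (a X\<^sup>2 + 2 b X Y + c Y\<^sup>2)\<close> with \<open>a c = b\<^sup>2 + D\<close>.
  The pair \<open>(a, b)\<close> determines \<open>\<beta>' / \<beta>\<close>, hence the lattice up to a factor.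
\<close>

definition basis_form :: "nat \<Rightarrow> int \<Rightarrow> int \<Rightarrow> complex \<Rightarrow> complex \<Rightarrow> bool" where
  "basis_form s a b \<beta> \<beta>' \<longleftrightarrow> \<beta> \<in> L s \<and> \<beta>' \<in> L s \<and> \<beta> \<noteq> 0 \<and> a > 0 \<and> a dvd b\<^sup>2 + int D \<and>
     of_int a * \<beta>' = (of_int b + \<omega>) * \<beta> \<and> \<beta> * cnj \<beta> = of_int (a * C ^ s) \<and>
     (\<forall>\<xi>\<in>L s. \<exists>i j :: int. \<xi> = of_int i * \<beta> + of_int j * \<beta>')"

lemma basis_formD:
  assumes "basis_form s a b \<beta> \<beta>'"
  shows "\<beta> \<in> L s" "\<beta>' \<in> L s" "\<beta> \<noteq> 0" "a > 0" "a dvd b\<^sup>2 + int D"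
    "of_int a * \<beta>' = (of_int b + \<omega>) * \<beta>" "\<beta> * cnj \<beta> = of_int (a * C ^ s)"
  using assms unfolding basis_form_def by - (elim conjE, assumption)+

lemma basis_form_span:
  assumes "basis_form s a b \<beta> \<beta>'" "\<xi> \<in> L s"
  obtains i j :: int where "\<xi> = of_int i * \<beta> + of_int j * \<beta>'"
  using assms unfolding basis_form_def by (elim conjE) (drule (1) bspec, elim exE, blast)

text \<open>A basis is \<open>C ^ s\<close> and \<open>t + \<omega>\<close>, where \<open>t\<close>
  is V/U modulo \<open>C ^ s\<close>. The norm equation divided by \<open>U\<^sup>2\<close> shows
  that \<open>C ^ s\<close> divides t^2 + D.\<close>

lemma basis_form_exists:
  assumes "s \<le> z"
  shows "\<exists>a b \<beta> \<beta>'. basis_form s a b \<beta> \<beta>'"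
proof -
  have "coprime U (C ^ s)" using coprime_U by simp
  then obtain u where u: "[U * u = 1] (mod (C ^ s))"
    using cong_solve_coprime_int by blast
  define t where "t = u * V"
  have tU: "C ^ s dvd V - t * U"
  proof -
    have "V - t * U = - (V * (U * u - 1))" by (simp add: t_def algebra_simps)
    then show ?thesis using u by (simp add: cong_iff_dvd_diff)
  qed
  have t: "elt t 1 \<in> L s"
    using tU by (simp add: elt_in_L_iff[OF assms])
  have cs: "of_int (C ^ s) \<in> L s"
    unfolding of_int_eq_elt elt_in_L_iff[OF assms] by simp
  have "U\<^sup>2 * (t\<^sup>2 + int D) = C ^ z - (V - t * U) * (V + t * U)"
    unfolding norm_eq[symmetric] by (simp add: algebra_simps power2_eq_square)
  moreover have "C ^ s dvd C ^ z" using assms by (rule le_imp_power_dvd)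
  ultimately have "C ^ s dvd U\<^sup>2 * (t\<^sup>2 + int D)"
    using tU by (metis dvd_diff dvd_mult2)
  moreover have "coprime (C ^ s) (U\<^sup>2)"
    using coprime_U by (simp add: coprime_commute)
  ultimately have dvd: "C ^ s dvd t\<^sup>2 + int D"
    using coprime_dvd_mult_right_iff by blast
  have span: "\<exists>i j :: int. \<xi> = of_int i * of_int (C ^ s) + of_int j * elt t 1" if \<xi>: "\<xi> \<in> L s" for \<xi>
  proof -
    obtain a b where ab: "\<xi> = elt a b" using \<xi> L_in_R R_cases by metis
    have "C ^ s dvd b * V - a * U"
      using \<xi> unfolding ab elt_in_L_iff[OF assms] .
    then have "C ^ s dvd b * (V - t * U) - (b * V - a * U)"
      using tU by (meson dvd_diff dvd_mult)
    also have "b * (V - t * U) - (b * V - a * U) = U * (a - b * t)"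
      by (simp add: algebra_simps)
    finally have "C ^ s dvd a - b * t"
      using coprime_U by (simp add: coprime_dvd_mult_right_iff coprime_commute)
    then obtain k where "a - b * t = C ^ s * k" ..
    then have "a = k * C ^ s + b * t" by (simp add: algebra_simps)
    then have "\<xi> = of_int k * of_int (C ^ s) + of_int b * elt t 1"
      by (simp add: ab elt_def algebra_simps)
    then show ?thesis by blast
  qed
  have "basis_form s (C ^ s) t (of_int (C ^ s)) (elt t 1)"
    unfolding basis_form_def using t cs dvd span C_gt_1 by (auto simp: elt_def mult.commute)
  then show ?thesis by blast
qed

text \<open>The translation step of form reduction: only the second basis vector changes, so
  \<open>a\<close> is kept.\<close>

lemma basis_form_shift:
  assumes "basis_form s a b \<beta> \<beta>'"
  shows "basis_form s a (b + k * a) \<beta> (\<beta>' + of_int k * \<beta>)"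
proof -
  have "(b + k * a)\<^sup>2 + int D = (b\<^sup>2 + int D) + a * (2 * b * k + k\<^sup>2 * a)"
    by (simp add: algebra_simps power2_eq_square)
  moreover have "a dvd b\<^sup>2 + int D" by (rule basis_formD(5)[OF assms])
  ultimately have 1: "a dvd (b + k * a)\<^sup>2 + int D"
    by (simp only: dvd_add dvd_triv_left)
  have 2: "\<exists>i j :: int. \<xi> = of_int i * \<beta> + of_int j * (\<beta>' + of_int k * \<beta>)" if \<xi>: "\<xi> \<in> L s" for \<xi>
  proof -
    obtain i j :: int where "\<xi> = of_int i * \<beta> + of_int j * \<beta>'"
      using basis_form_span[OF assms \<xi>] by blast
    then have "\<xi> = of_int (i - j * k) * \<beta> + of_int j * (\<beta>' + of_int k * \<beta>)"
      by (simp add: algebra_simps)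
    then show ?thesis by blast
  qed
  have 3: "of_int a * (\<beta>' + of_int k * \<beta>) = (of_int (b + k * a) + \<omega>) * \<beta>"
    using basis_formD(6)[OF assms] by (simp add: ring_distribs mult_ac)
  have "\<beta>' + of_int k * \<beta> \<in> L s"
    by (intro L_add L_mult basis_formD[OF assms] R_of_int)
  then show ?thesis
    unfolding basis_form_def by (intro conjI ballI basis_formD[OF assms] 1 2 3)
qed

text \<open>The inversion step of form reduction: exchanging the basis vectors, with a sign to keep
  the orientation, turns (a, 2b, c) into (c, -2b, a).\<close>

lemma basis_form_swap:
  assumes "basis_form s a b \<beta> \<beta>'" "a * c = b\<^sup>2 + int D"
  shows "basis_form s c (- b) \<beta>' (- \<beta>)"
proof -
  have a: "a > 0" and eq: "of_int a * \<beta>' = (of_int b + \<omega>) * \<beta>" and nz: "\<beta> \<noteq> 0"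
    by (rule basis_formD[OF assms(1)])+
  have "a * c > 0" using assms(2) D_pos
    by (smt (verit) of_nat_0_less_iff zero_le_power2)
  then have c: "c > 0" using a by (simp add: zero_less_mult_iff)
  have bw: "(of_int b + \<omega>) * (of_int b - \<omega>) = of_int (a * c)"
    unfolding assms(2) using omega_square by (simp add: algebra_simps power2_eq_square)
  have "of_int a * ((of_int b - \<omega>) * \<beta>') = of_int (a * c) * \<beta>"
    using eq bw by (metis (no_types, lifting) mult.commute mult.left_commute)
  then have "of_int a * ((of_int b - \<omega>) * \<beta>') = of_int a * (of_int c * \<beta>)"
    by simp
  then have "(of_int b - \<omega>) * \<beta>' = of_int c * \<beta>"
    using a by (metis mult_left_cancel of_int_eq_0_iff less_irrefl)
  then have eq': "of_int c * (- \<beta>) = (of_int (- b) + \<omega>) * \<beta>'"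
    by (simp add: algebra_simps)
  have "\<beta>' \<noteq> 0"
  proof
    assume "\<beta>' = 0"
    then have "of_int c * \<beta> = 0" using eq' by simp
    then show False using nz c by simp
  qed
  moreover have "- \<beta> \<in> L s"
    using L_mult[OF basis_formD(1)[OF assms(1)] R_of_int[of "- 1"]] by simp
  moreover have "\<exists>i j :: int. \<xi> = of_int i * \<beta>' + of_int j * (- \<beta>)" if \<xi>: "\<xi> \<in> L s" for \<xi>
  proof -
    obtain i j :: int where "\<xi> = of_int i * \<beta> + of_int j * \<beta>'"
      using basis_form_span[OF assms(1) \<xi>] by blast
    then have "\<xi> = of_int j * \<beta>' + of_int (- i) * (- \<beta>)"
      by simp
    then show ?thesis by blast
  qed
  moreover have "c dvd (- b)\<^sup>2 + int D"
    using assms(2) by (metis dvd_triv_right power2_minus)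
  moreover have "\<beta>' * cnj \<beta>' = of_int (c * C ^ s)"
  proof -
    have "of_int (a * a) * (\<beta>' * cnj \<beta>') = (of_int a * \<beta>') * cnj (of_int a * \<beta>')"
      by simp
    also have "\<dots> = ((of_int b + \<omega>) * (of_int b - \<omega>)) * (\<beta> * cnj \<beta>)"
      unfolding eq by (simp add: cnj_omega)
    also have "\<dots> = of_int (a * a) * of_int (c * C ^ s)"
      unfolding bw basis_formD(7)[OF assms(1)] by simp
    finally show ?thesis using a by simp
  qed
  ultimately show ?thesis
    unfolding basis_form_def using basis_formD(2)[OF assms(1)] c eq' by (intro conjI ballI) simp_all
qed

text \<open>Gauss reduction: translate until 2|b| \<le> a, then invert if c < a. Each inversion
  lowers the first coefficient, so the process ends with a \<le> c.\<close>

lemma reduced_basis_form_exists: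
  assumes "s \<le> z"
  shows "\<exists>a b \<beta> \<beta>'. basis_form s a b \<beta> \<beta>' \<and> (a, b) \<in> reduced_pairs"
proof -
  have "\<exists>a b \<beta> \<beta>'. basis_form s a b \<beta> \<beta>' \<and> (a, b) \<in> reduced_pairs" if "basis_form s a b \<beta> \<beta>'" for a b \<beta> \<beta>'
    using that
  proof (induction "nat a" arbitrary: a b \<beta> \<beta>' rule: less_induct)
    case less
    have a: "a > 0" by (rule basis_formD(4)[OF less.prems])
    \<comment> \<open>This \<open>k\<close> makes \<open>2 * b' + a\<close> the remainder of 2b + a
      modulo 2a, so \<open>b'\<close> is the residue of \<open>b\<close> modulo \<open>a\<close> in
      [-a/2, a/2).\<close>
    define k where "k = - ((2 * b + a) div (2 * a))"
    define b' where "b' = b + k * a"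
    have "2 * b' + a = (2 * b + a) mod (2 * a)"
      by (simp add: b'_def k_def minus_div_mult_eq_mod[symmetric] algebra_simps)
    then have "0 \<le> 2 * b' + a" "2 * b' + a < 2 * a"
      using a by simp_all
    then have b': "2 * \<bar>b'\<bar> \<le> a" by linarith
    have bf: "basis_form s a b' \<beta> (\<beta>' + of_int k * \<beta>)"
      unfolding b'_def by (rule basis_form_shift[OF less.prems])
    then obtain c where c: "a * c = b'\<^sup>2 + int D"
      using basis_formD(5) by (metis dvdE)
    show ?case
    proof (cases "c < a")
      case True
      then have "nat c < nat a" using a by simp
      then show ?thesis
        using less.hyps basis_form_swap[OF bf c] by blast
    next
      case False
      then have "a * a \<le> b'\<^sup>2 + int D"
        using a unfolding c[symmetric] by (intro mult_left_mono) auto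
      moreover have "4 * b'\<^sup>2 \<le> a\<^sup>2"
        using power_mono[OF b', of 2] by (simp add: power_mult_distrib)
      ultimately have "(a, b') \<in> reduced_pairs"
        using a b' by (simp add: reduced_pairs_def power2_eq_square)
      then show ?thesis using bf by blast
    qed
  qed
  then show ?thesis using basis_form_exists[OF assms] by blast
qed

section \<open>Generators of the ideals and the representation of \<open>\<alpha>\<close> as a
  power\<close>

text \<open>For \<open>s \<le> z\<close> this says that \<open>\<gamma>\<close> generates the ideal
  \<open>L s\<close>, because \<open>L s\<close> has norm \<open>C ^ s\<close>.\<close>

definition principal :: "nat \<Rightarrow> complex \<Rightarrow> bool" where
  "principal s \<gamma> \<longleftrightarrow> \<gamma> \<in> L s \<and> \<gamma> * cnj \<gamma> = of_int (C ^ s)"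

text \<open>If \<open>M\<close> is the largest admissible \<open>a\<close>, each \<open>a\<close>
  allows at most M + 1 values of \<open>b\<close>, and M(M + 1) \<le> 2M^2 \<le> 8D/3. This count
  replaces the class number.\<close>

lemma card_reduced_pairs: "finite reduced_pairs" "card reduced_pairs \<le> 3 * D"
proof -
  define M where "M = nat (Max {a :: int. 0 \<le> a \<and> 3 * a\<^sup>2 \<le> 4 * int D})"
  let ?S = "{a :: int. 0 \<le> a \<and> 3 * a\<^sup>2 \<le> 4 * int D}"
  have bd: "a \<le> 4 * int D" if "a \<in> ?S" for a
  proof -
    have "a \<le> a\<^sup>2" using that self_le_power[of a 2] by (cases "a = 0") auto
    then show ?thesis using that by auto
  qed
  have fin: "finite ?S"
  proof (rule finite_subset)
    show "?S \<subseteq> {0..4 * int D}"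
    proof
      fix a assume "a \<in> ?S"
      with bd[OF this] show "a \<in> {0..4 * int D}" by simp
    qed
  qed simp
  have "1 \<in> ?S" using D_pos by auto
  then have "Max ?S \<in> ?S" using fin by (intro Max_in) auto
  moreover have "Max ?S \<ge> 1" using fin \<open>1 \<in> ?S\<close> by (intro Max_ge) auto
  ultimately have M: "3 * (int M)\<^sup>2 \<le> 4 * int D" "int M = Max ?S" "M \<ge> 1"
    by (auto simp: M_def)
  have sub: "reduced_pairs \<subseteq> {1..int M} \<times> {- (int M div 2)..int M div 2}"
  proof (rule subrelI, unfold mem_Sigma_iff, intro conjI)
    fix a b assume "(a, b) \<in> reduced_pairs"
    then have ab: "0 < a" "2 * \<bar>b\<bar> \<le> a" "a \<in> ?S" by (auto simp: reduced_pairs_def)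
    then have "a \<le> int M" unfolding M(2) using fin by simp
    then show "a \<in> {1..int M}" "b \<in> {- (int M div 2)..int M div 2}"
      using ab by auto
  qed
  show "finite reduced_pairs" by (rule finite_subset[OF sub]) auto
  have "card reduced_pairs \<le> card ({1..int M} \<times> {- (int M div 2)..int M div 2})"
    by (intro card_mono sub) auto
  also have "\<dots> = M * (2 * (M div 2) + 1)"
  proof -
    have "int M div 2 = int (M div 2)" by (simp add: zdiv_int)
    then have "nat (int M div 2 - - (int M div 2) + 1) = 2 * (M div 2) + 1" by simp
    then show ?thesis by (simp add: card_cartesian_product)
  qed
  also have "\<dots> \<le> M * (M + 1)"
    by (intro mult_left_mono) auto
  also have "\<dots> \<le> 2 * M\<^sup>2"
    using M(3) by (simp add: power2_eq_square)
  also have "\<dots> \<le> 3 * D"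
    using M(1) of_nat_le_iff[where 'a = int, of "3 * M\<^sup>2" "4 * D"] by simp
  finally show "card reduced_pairs \<le> 3 * D" .
qed

text \<open>Among \<open>L 0\<close>, ..., \<open>L (3 * D)\<close> two lattices share a reduced
  pair, hence differ by a factor \<open>\<gamma>\<close>, which then generates
  \<open>L (s' - s)\<close>. The hypothesis keeps all indices within \<open>z\<close>.\<close>

lemma principal_exists:
  assumes "3 * D \<le> z"
  shows "\<exists>h \<gamma>. 0 < h \<and> h \<le> 3 * D \<and> principal h \<gamma>"
proof -
  have "\<forall>s\<in>{..3 * D}. \<exists>p \<beta> \<beta>'. basis_form s (fst p) (snd p) \<beta> \<beta>' \<and> p \<in> reduced_pairs"
  proof
    fix s assume "s \<in> {..3 * D}"
    then obtain a b \<beta> \<beta>' where "basis_form s a b \<beta> \<beta>'" "(a, b) \<in> reduced_pairs"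
      using reduced_basis_form_exists[of s] assms by auto
    then show "\<exists>p \<beta> \<beta>'. basis_form s (fst p) (snd p) \<beta> \<beta>' \<and> p \<in> reduced_pairs"
      by (intro exI[of _ "(a, b)"] exI[of _ \<beta>] exI[of _ \<beta>']) simp
  qed
  then obtain p \<beta> \<beta>' where p: "\<And>s. s \<le> 3 * D \<Longrightarrow> basis_form s (fst (p s)) (snd (p s)) (\<beta> s) (\<beta>' s)"
    and p_mem: "p ` {..3 * D} \<subseteq> reduced_pairs"
    unfolding image_subset_iff bchoice_iff by (auto simp: atMost_iff)
  have "card (p ` {..3 * D}) \<le> 3 * D"
    using card_mono[OF card_reduced_pairs(1) p_mem] card_reduced_pairs(2) by linarith
  then have "\<not> inj_on p {..3 * D}"
    by (intro pigeonhole) simp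
  then obtain s s' where s: "s < s'" "s' \<le> 3 * D" "p s = p s'"
    unfolding inj_on_def by (metis atMost_iff linorder_neqE_nat)
  obtain a b where ab: "p s = (a, b)" by fastforce
  define \<gamma> where "\<gamma> = \<beta> s' / \<beta> s"
  have bf: "basis_form s a b (\<beta> s) (\<beta>' s)" "basis_form s' a b (\<beta> s') (\<beta>' s')"
    using p[of s] p[of s'] s(1,2) unfolding s(3)[symmetric] ab by simp_all
  have nz: "\<beta> s \<noteq> 0" "\<beta> s' \<noteq> 0" "of_int a \<noteq> (0 :: complex)"
    using basis_formD(3,4)[OF bf(1)] basis_formD(3)[OF bf(2)] by simp_all
  have \<gamma>\<beta>: "\<gamma> * \<beta> s = \<beta> s'"
    using nz by (simp add: \<gamma>_def)
  \<comment> \<open>The common pair gives both bases the same ratio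
    \<open>(b + \<omega>) / a\<close>.\<close>
  have "of_int a * (\<gamma> * \<beta>' s) = of_int a * \<beta>' s'"
    using basis_formD(6)[OF bf(1)] basis_formD(6)[OF bf(2)] \<gamma>\<beta> by (metis mult.left_commute)
  then have \<gamma>\<beta>': "\<gamma> * \<beta>' s = \<beta>' s'"
    using nz by simp
  have maps: "\<gamma> * \<xi> \<in> L s'" if \<xi>: "\<xi> \<in> L s" for \<xi>
  proof -
    obtain i j :: int where "\<xi> = of_int i * \<beta> s + of_int j * \<beta>' s"
      using basis_form_span[OF bf(1) \<xi>] by blast
    then have "\<gamma> * \<xi> = of_int i * \<beta> s' + of_int j * \<beta>' s'"
      unfolding \<gamma>\<beta>[symmetric] \<gamma>\<beta>'[symmetric] by (simp add: algebra_simps)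
    then show ?thesis
      by (simp only:) (intro L_add L_mult basis_formD[OF bf(2)] R_of_int)
  qed
  \<comment> \<open>So far \<open>\<gamma>\<close> is only a quotient. Its values on the elements
    \<open>C ^ s\<close> and \<open>\<alpha>\<close> of \<open>L s\<close> lie in
    \<open>L s'\<close>, so \<open>C ^ s\<close> divides \<open>\<pi>\<close> times
    \<open>\<alpha>\<close> and \<open>\<pi>\<close> times its conjugate; hence it divides
    \<open>\<pi>\<close>.\<close>
  define \<pi> where "\<pi> = \<gamma> * of_int (C ^ s)"
  have "of_int (C ^ s) \<in> L s"
    unfolding of_int_eq_elt using s assms by (subst elt_in_L_iff) auto
  then have \<pi>: "\<pi> \<in> L s'"
    unfolding \<pi>_def by (rule maps)
  have "\<gamma> * \<alpha> \<in> R"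
    using maps[OF \<alpha>_in_L] s assms L_in_R by auto
  then have "divides (C ^ s) (\<pi> * \<alpha>)"
    unfolding divides_def \<pi>_def by (metis mult.assoc mult.commute)
  moreover have "divides (C ^ s) (\<pi> * cnj \<alpha>)"
    using L_mono[OF _ \<pi>, of s] s by (simp add: L_def)
  ultimately have "divides (C ^ s) \<pi>"
    using divides_of_trace L_in_R[OF \<pi>] by blast
  then have \<gamma>R: "\<gamma> \<in> R"
    using C_gt_1 unfolding divides_def \<pi>_def by auto
  obtain \<eta> where "\<eta> \<in> R" "\<pi> * cnj \<alpha> = of_int (C ^ s') * \<eta>"
    using \<pi> unfolding L_def divides_def by blast
  moreover have "C ^ s' = C ^ s * C ^ (s' - s)"
    using s by (simp flip: power_add)
  ultimately have "\<gamma> * cnj \<alpha> = of_int (C ^ (s' - s)) * \<eta>"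
    using C_gt_1 unfolding \<pi>_def by simp
  then have \<gamma>L: "\<gamma> \<in> L (s' - s)"
    using \<gamma>R \<open>\<eta> \<in> R\<close> unfolding L_def divides_def by blast
  have "of_int (a * C ^ s') = (\<gamma> * \<beta> s) * cnj (\<gamma> * \<beta> s)"
    unfolding \<gamma>\<beta> basis_formD(7)[OF bf(2)] ..
  also have "\<dots> = (\<gamma> * cnj \<gamma>) * of_int (a * C ^ s)"
    using basis_formD(7)[OF bf(1)] by simp
  finally have "\<gamma> * cnj \<gamma> = of_int (C ^ (s' - s))"
    using nz C_gt_1 \<open>C ^ s' = C ^ s * C ^ (s' - s)\<close> by simp
  then have "principal (s' - s) \<gamma>"
    using \<gamma>L by (simp add: principal_def)
  then show ?thesis
    using s by (intro exI[of _ "s' - s"] exI[of _ \<gamma>]) auto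
qed

text \<open>To contain is to divide. The quotient is \<open>cnj \<gamma> * \<beta> / C ^ s\<close>,
  and it is integral because \<open>C ^ s\<close> divides both
  \<open>cnj \<gamma> * \<alpha>\<close> and \<open>\<beta> * cnj \<alpha>\<close>.\<close>

lemma principal_division:
  assumes "principal s \<gamma>" "principal s' \<beta>" "s \<le> s'"
  shows "\<exists>\<kappa>. principal (s' - s) \<kappa> \<and> \<beta> = \<gamma> * \<kappa>"
proof -
  have \<gamma>: "\<gamma> \<in> L s" "\<gamma> * cnj \<gamma> = of_int (C ^ s)" and \<beta>: "\<beta> \<in> L s'" "\<beta> * cnj \<beta> = of_int (C ^ s')"
    using assms by (auto simp: principal_def)
  have R: "\<gamma> \<in> R" "\<beta> \<in> R" using \<gamma> \<beta> L_in_R by auto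
  have C: "C ^ s' = C ^ s * C ^ (s' - s)" using assms(3) by (simp flip: power_add)
  have "divides (C ^ s) (cnj (\<gamma> * cnj \<alpha>))"
    using \<gamma>(1) by (intro divides_cnj) (simp add: L_def)
  then have "divides (C ^ s) (cnj \<gamma> * \<alpha>)" by simp
  then have "divides (C ^ s) (cnj \<gamma> * \<alpha> * \<beta>)"
    using R(2) by (rule divides_mult_right)
  then have 1: "divides (C ^ s) (cnj \<gamma> * \<beta> * \<alpha>)"
    by (simp add: mult_ac)
  have "divides (C ^ s) (\<beta> * cnj \<alpha>)"
    using L_mono[OF assms(3) \<beta>(1)] by (simp add: L_def)
  then have "divides (C ^ s) (cnj \<gamma> * \<beta> * cnj \<alpha>)"
    using R by (simp add: divides_mult_left R_cnj mult.assoc)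
  then have "divides (C ^ s) (cnj \<gamma> * \<beta>)"
    by (rule divides_of_trace[OF R_mult[OF R_cnj[OF R(1)] R(2)] 1])
  then obtain \<kappa> where \<kappa>: "\<kappa> \<in> R" "cnj \<gamma> * \<beta> = of_int (C ^ s) * \<kappa>"
    unfolding divides_def by blast
  have C0: "complex_of_int (C ^ s) \<noteq> 0" using C_gt_1 by simp
  have "of_int (C ^ s) * \<beta> = of_int (C ^ s) * (\<gamma> * \<kappa>)"
    unfolding \<gamma>(2)[symmetric] using \<kappa>(2) \<gamma>(2) by (metis mult.assoc mult.left_commute)
  then have \<beta>\<kappa>: "\<beta> = \<gamma> * \<kappa>" using C0 by (metis mult_left_cancel)
  have "of_int (C ^ s') = (\<gamma> * cnj \<gamma>) * (\<kappa> * cnj \<kappa>)"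
    using \<beta>(2) unfolding \<beta>\<kappa> by (simp add: mult_ac)
  then have norm: "\<kappa> * cnj \<kappa> = of_int (C ^ (s' - s))"
    using C_gt_1 unfolding \<gamma>(2) C by simp
  obtain \<eta> where \<eta>: "\<eta> \<in> R" "\<beta> * cnj \<alpha> = of_int (C ^ s') * \<eta>"
    using \<beta>(1) unfolding L_def divides_def by blast
  have "of_int (C ^ s) * (\<kappa> * cnj \<alpha>) = cnj \<gamma> * (\<beta> * cnj \<alpha>)"
    using \<kappa>(2) by (simp add: mult.assoc[symmetric])
  also have "\<dots> = of_int (C ^ s) * (of_int (C ^ (s' - s)) * (cnj \<gamma> * \<eta>))"
    unfolding \<eta>(2) C by simp
  finally have "\<kappa> * cnj \<alpha> = of_int (C ^ (s' - s)) * (cnj \<gamma> * \<eta>)"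
    using C0 by (metis mult_left_cancel)
  then have "\<kappa> \<in> L (s' - s)"
    unfolding L_def divides_def using \<kappa>(1) \<eta>(1) R by blast
  then show ?thesis
    using norm \<beta>\<kappa> by (auto simp: principal_def)
qed

text \<open>Dividing by \<open>\<gamma>\<close> lowers the exponent by \<open>h\<close>. Minimality
  forbids exponents strictly between 0 and \<open>h\<close>, so the descent ends at 0 with an
  element of norm 1.\<close>

lemma principal_power:
  assumes "0 < h" "principal h \<gamma>" and minimal: "\<And>s \<beta>. 0 < s \<Longrightarrow> s < h \<Longrightarrow> \<not> principal s \<beta>"
  shows "principal s \<beta> \<Longrightarrow> \<exists>q \<epsilon>. s = h * q \<and> \<beta> = \<gamma> ^ q * \<epsilon> \<and> principal 0 \<epsilon>"
proof (induction s arbitrary: \<beta> rule: less_induct)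
  case (less s)
  show ?case
  proof (cases "s = 0")
    case True
    then show ?thesis using less.prems by (intro exI[of _ 0] exI[of _ \<beta>]) simp
  next
    case False
    then have "h \<le> s" using minimal[of s \<beta>] less.prems by linarith
    then obtain \<kappa> where \<kappa>: "principal (s - h) \<kappa>" "\<beta> = \<gamma> * \<kappa>"
      using principal_division[OF assms(2) less.prems] by blast
    moreover have "s - h < s" using False assms(1) by simp
    ultimately obtain q \<epsilon> where "s - h = h * q" "\<kappa> = \<gamma> ^ q * \<epsilon>" "principal 0 \<epsilon>"
      using less.IH by blast
    moreover from this have "s = h * Suc q"
      using \<open>h \<le> s\<close> by simp
    moreover have "\<beta> = \<gamma> ^ Suc q * \<epsilon>"
      using \<kappa>(2) \<open>\<kappa> = _\<close> by simp
    ultimately show ?thesis by blast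
  qed
qed

text \<open>The least positive exponent with a generator serves as \<open>h\<close>. Squaring
  \<open>\<alpha>\<close> reduces the unknown unit to a sign.\<close>

lemma \<alpha>_power_generator:
  assumes "3 * D \<le> z"
  shows "\<exists>h q \<gamma>. 0 < h \<and> h \<le> 3 * D \<and> z = h * q \<and> \<gamma> \<in> R \<and>
    \<gamma> * cnj \<gamma> = of_int (C ^ h) \<and> (\<alpha>\<^sup>2 = \<gamma> ^ (2 * q) \<or> \<alpha>\<^sup>2 = - (\<gamma> ^ (2 * q)))"
proof -
  define h where "h = (LEAST h. 0 < h \<and> (\<exists>\<gamma>. principal h \<gamma>))"
  obtain h' \<gamma>' where h': "0 < h'" "h' \<le> 3 * D" "principal h' \<gamma>'"
    using principal_exists[OF assms] by blast
  then have ex: "\<exists>h. 0 < h \<and> (\<exists>\<gamma>. principal h \<gamma>)" by blast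
  have "0 < h \<and> (\<exists>\<gamma>. principal h \<gamma>)"
    unfolding h_def by (rule LeastI_ex[OF ex])
  then obtain \<gamma> where h: "0 < h" "principal h \<gamma>" by blast
  have "h \<le> h'"
    unfolding h_def by (rule Least_le) (use h' in blast)
  then have "h \<le> 3 * D" using h'(2) by simp
  have minimal: "\<not> principal s \<beta>" if "0 < s" "s < h" for s \<beta>
    using not_less_Least[of s "\<lambda>h. 0 < h \<and> (\<exists>\<gamma>. principal h \<gamma>)"] that unfolding h_def by blast
  have "principal z \<alpha>"
    using \<alpha>_in_L \<alpha>_norm by (simp add: principal_def)
  then obtain q \<epsilon> where q: "z = h * q" "\<alpha> = \<gamma> ^ q * \<epsilon>" "principal 0 \<epsilon>"
    using principal_power[OF h minimal] by blast
  have "\<epsilon>\<^sup>2 = 1 \<or> \<epsilon>\<^sup>2 = - 1"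
    using q(3) L_in_R by (intro norm_1_square) (auto simp: principal_def)
  moreover have "\<alpha>\<^sup>2 = \<gamma> ^ (2 * q) * \<epsilon>\<^sup>2"
    by (simp add: q(2) power_mult_distrib power_mult[symmetric] mult.commute)
  ultimately have "\<alpha>\<^sup>2 = \<gamma> ^ (2 * q) \<or> \<alpha>\<^sup>2 = - (\<gamma> ^ (2 * q))" by auto
  then show ?thesis
    using h \<open>h \<le> 3 * D\<close> q(1) L_in_R unfolding principal_def by blast
qed

text \<open>As \<open>C\<close> divides the norm of \<open>\<alpha>\<close>, modulo \<open>C\<close>
  the square of \<open>\<alpha>\<close> is 2V\<alpha>, so \<open>\<alpha> ^ m\<close> is (2V)^(m-1)
  \<alpha>. Its imaginary part is prime to \<open>C\<close>, hence not 0.\<close>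

lemma \<alpha>_power_not_int:
  assumes "m > 0" "z > 0"
  shows "\<alpha> ^ m \<noteq> of_int c"
proof
  assume c: "\<alpha> ^ m = of_int c"
  have "divides C (\<alpha> ^ Suc k - of_int ((2 * V) ^ k) * \<alpha>)" for k
  proof (induction k)
    case 0
    have "divides C (elt 0 0)" unfolding divides_elt_iff by simp
    then show ?case by (simp add: elt_def)
  next
    case (Suc k)
    have "C dvd C ^ z" using assms(2) by simp
    then have "divides C (elt (- ((2 * V) ^ k * C ^ z)) 0)"
      unfolding divides_elt_iff by simp
    moreover have "\<alpha> ^ Suc (Suc k) - of_int ((2 * V) ^ Suc k) * \<alpha> =
        (\<alpha> ^ Suc k - of_int ((2 * V) ^ k) * \<alpha>) * \<alpha> + elt (- ((2 * V) ^ k * C ^ z)) 0"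
    proof -
      have "\<alpha> * \<alpha> = of_int (2 * V) * \<alpha> - of_int (C ^ z)"
        unfolding \<alpha>_trace[symmetric] \<alpha>_norm[symmetric] by (simp add: algebra_simps)
      then have "of_int ((2 * V) ^ k) * (\<alpha> * \<alpha>) = of_int ((2 * V) ^ Suc k) * \<alpha> - of_int ((2 * V) ^ k * C ^ z)"
        by (simp only:) (simp add: algebra_simps)
      then show ?thesis
        unfolding of_int_eq_elt[symmetric] by (simp add: algebra_simps)
    qed
    ultimately show ?case
      using divides_add[OF divides_mult_right[OF Suc \<alpha>_in_R]] by presburger
  qed
  from this[of "m - 1"] have "divides C (of_int c - of_int ((2 * V) ^ (m - 1)) * \<alpha>)"
    using assms(1) c by simp
  moreover have "of_int c - of_int ((2 * V) ^ (m - 1)) * \<alpha> =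
      elt (c - (2 * V) ^ (m - 1) * V) (- ((2 * V) ^ (m - 1) * U))"
    by (simp add: \<alpha>_def elt_def algebra_simps)
  ultimately have "C dvd (2 * V) ^ (m - 1) * U"
    by (simp only: divides_elt_iff dvd_minus_iff)
  moreover have "coprime C ((2 * V) ^ (m - 1))" "coprime C U"
    using coprime_V coprime_U C_odd by (simp_all add: coprime_commute)
  ultimately have "C dvd 1"
    by (metis coprime_dvd_mult_right_iff coprime_common_divisor dvd_refl)
  then show False using C_gt_1 by simp
qed

text \<open>Up to sign, \<open>\<alpha> ^ (2 * r)\<close> is the power \<open>2 * q\<close> of
  \<open>\<gamma> ^ r\<close>. Since \<open>A ^ x\<close> divides \<open>U\<close>, it divides the
  imaginary part of the former; lifting the exponent transfers this to
  \<open>2 * q * v\<close>.\<close>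

lemma imaginary_part_bound:
  fixes A :: nat
  assumes z: "3 * D \<le> z" and A: "A > 0" "coprime C (int A)" "int A ^ x dvd U"
  shows "\<exists>h q r v. h \<le> 3 * D \<and> z = h * q \<and> r \<le> (\<Sum>g | g dvd A. A div g) \<and> v \<noteq> 0 \<and>
    v\<^sup>2 \<le> C ^ (h * r) \<and> int A ^ x dvd 2 * int q * v"
proof -
  obtain h q \<gamma> where h: "0 < h" "h \<le> 3 * D" "z = h * q" and \<gamma>: "\<gamma> \<in> R" "\<gamma> * cnj \<gamma> = of_int (C ^ h)"
    and \<alpha>\<gamma>: "\<alpha>\<^sup>2 = \<gamma> ^ (2 * q) \<or> \<alpha>\<^sup>2 = - (\<gamma> ^ (2 * q))"
    using \<alpha>_power_generator[OF z] by blast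
  have "coprime (C ^ h) (int A)" using A(2) by simp
  then obtain r u v where r: "0 < r" "r \<le> (\<Sum>g | g dvd A. A div g)" "\<gamma> ^ r = elt u v" "int A dvd v"
    using rank_exists[OF \<gamma> A(1)] by blast
  have "of_int (u\<^sup>2 + int D * v\<^sup>2) = \<gamma> ^ r * cnj (\<gamma> ^ r)"
    unfolding r(3) elt_norm ..
  also have "\<dots> = (\<gamma> * cnj \<gamma>) ^ r" by (simp add: power_mult_distrib)
  also have "\<dots> = of_int (C ^ (h * r))" unfolding \<gamma>(2) by (simp add: power_mult)
  finally have norm: "u\<^sup>2 + int D * v\<^sup>2 = C ^ (h * r)" by (simp only: of_int_eq_iff)
  have "v\<^sup>2 \<le> int D * v\<^sup>2" using D_pos by (simp add: mult_le_cancel_right1)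
  then have v_le: "v\<^sup>2 \<le> C ^ (h * r)" unfolding norm[symmetric] by (simp add: add_increasing)
  have "coprime (C ^ (h * r)) (int A)" using A(2) by simp
  \<comment> \<open>As \<open>A\<close> divides \<open>v\<close>, a common divisor of
    \<open>u\<^sup>2\<close> and \<open>A\<close> would divide the norm \<open>C ^ (h * r)\<close>,
    which is prime to \<open>A\<close>.\<close>
  then have "coprime (u\<^sup>2) (int A)"
    unfolding norm[symmetric] using r(4)
    by (smt (verit) coprimeI coprime_def dvd_add dvd_mult dvd_trans power2_eq_square)
  then have cop: "coprime u (int A)" by simp
  have \<alpha>r: "\<alpha> ^ (2 * r) = elt u v ^ (2 * q) \<or> \<alpha> ^ (2 * r) = - (elt u v ^ (2 * q))"
  proof -
    have "elt u v ^ (2 * q) = (\<gamma> ^ (2 * q)) ^ r"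
      unfolding r(3)[symmetric] by (simp flip: power_mult add: mult_ac)
    moreover have "\<alpha> ^ (2 * r) = (\<alpha>\<^sup>2) ^ r" by (rule power_mult)
    ultimately show ?thesis
      using \<alpha>\<gamma> by (cases "even r") (auto simp: power_minus_odd power_minus_even)
  qed
  have "z > 0" using z D_pos by simp
  \<comment> \<open>Only a nonzero \<open>v\<close> turns the divisibility by \<open>A ^ x\<close>
    into a bound on its size.\<close>
  have "v \<noteq> 0"
  proof
    assume "v = 0"
    then have "elt u v ^ (2 * q) = of_int (u ^ (2 * q))" by (simp add: elt_def)
    then have "\<exists>c. \<alpha> ^ (2 * r) = of_int c" using \<alpha>r by (metis of_int_minus)
    then show False using \<alpha>_power_not_int[of "2 * r"] r(1) \<open>z > 0\<close> by auto
  qed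
  obtain J K where JK: "\<alpha> ^ (2 * r) =
      elt (V ^ (2 * r) + U\<^sup>2 * J) (int (2 * r) * V ^ (2 * r - 1) * U + U ^ 3 * K)"
    unfolding \<alpha>_def using elt_power_expansion by blast
  have dvd: "int A ^ x dvd int (2 * r) * V ^ (2 * r - 1) * U + U ^ 3 * K"
    using A(3) by (simp add: power3_eq_cube)
  have "\<exists>a b. elt u v ^ (2 * q) = elt a b \<and> int A ^ x dvd b"
  proof -
    have "- elt a b = elt (- a) (- b)" for a b by (simp add: elt_def)
    then show ?thesis using \<alpha>r dvd unfolding JK by (metis dvd_minus_iff minus_minus)
  qed
  then have "int A ^ x dvd int (2 * q) * v"
    using power_dvd_im_power[OF r(4) cop, of "2 * q"] A(1) by (metis less_irrefl of_nat_eq_0_iff)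
  then show ?thesis
    using h r(2) \<open>v \<noteq> 0\<close> v_le
    by (intro exI[of _ h] exI[of _ q] exI[of _ r] exI[of _ v]) simp
qed

end

section \<open>Reduction and size estimates\<close>

text \<open>The sum is \<open>A\<close> times the sum of 1/g over the divisors g, which is at most a
  harmonic number. The difference \<open>harm - ln\<close> decreases from its value 1 at 1.\<close>

lemma sum_divisors_le:
  assumes "A > 0"
  shows "real (\<Sum>g | g dvd A. A div g) \<le> real A * (1 + ln (real A))"
proof -
  have "real (\<Sum>g | g dvd A. A div g) = (\<Sum>g | g dvd A. real A * inverse (real g))"
    unfolding of_nat_sum by (intro sum.cong refl) (simp add: real_of_nat_div divide_inverse)
  also have "\<dots> \<le> (\<Sum>g\<in>{1..A}. real A * inverse (real g))"
    using assms by (intro sum_mono2) (auto intro: Nat.gr0I dvd_imp_le simp: Suc_le_eq)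
  also have "\<dots> = real A * harm A"
    by (simp add: harm_def sum_distrib_left)
  also have "\<dots> \<le> real A * (1 + ln (real A))"
    using decseq_harm_diff_ln[THEN decseqD, of 0 "A - 1"] assms
    by (intro mult_left_mono) (simp_all add: harm_expand)
  finally show ?thesis .
qed

lemma coprime_sum_squares:
  fixes a b :: nat
  assumes "coprime a b"
  shows "coprime a (a\<^sup>2 + b\<^sup>2)"
proof (rule coprimeI)
  fix d assume d: "d dvd a" "d dvd a\<^sup>2 + b\<^sup>2"
  then have "d dvd b\<^sup>2"
    by (metis dvd_add_right_iff dvd_mult power2_eq_square)
  moreover have "coprime a (b\<^sup>2)" using assms by simp
  ultimately show "is_unit d"
    using d(1) coprime_common_divisor by blast
qed

text \<open>For odd \<open>k\<close> the squarefree part of \<open>n\<close> serves as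
  \<open>D\<close>: its primes occur once and divide \<open>B\<close>, so it divides
  \<open>B\<close>. The bound on \<open>D\<close> is thereby independent of
  \<open>n\<close>.\<close>

lemma power_eq_small_times_square:
  fixes n B k :: nat
  assumes "n > 0" "B > 0" and primes: "\<And>p. prime p \<Longrightarrow> p dvd n \<Longrightarrow> p dvd B"
  obtains D W where "n ^ k = D * W\<^sup>2" "0 < D" "D \<le> B"
proof (cases "even k")
  case True
  then have "n ^ k = 1 * (n ^ (k div 2))\<^sup>2" by (simp flip: power_mult)
  then show ?thesis using that[of 1] assms(2) by simp
next
  case False
  let ?D = "squarefree_part n"
  have "?D dvd B"
  proof (rule multiplicity_le_imp_dvd)
    fix p :: nat assume p: "prime p"
    show "multiplicity p ?D \<le> multiplicity p B"
    proof (cases "p dvd n")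
      case True
      then have "multiplicity p B \<ge> 1"
        using primes p assms(2) by (intro multiplicity_geI) (auto simp: not_prime_unit)
      moreover have "multiplicity p ?D \<le> 1"
        using p by (simp add: prime_multiplicity_squarefree_part)
      ultimately show ?thesis by simp
    next
      case False
      then show ?thesis
        using p by (simp add: prime_multiplicity_squarefree_part not_dvd_imp_multiplicity_0)
    qed
  qed simp
  then have "?D \<le> B" using assms(2) by (rule dvd_imp_le)
  have "k = Suc (2 * (k div 2))" using False by presburger
  then have "n ^ k = n * (n ^ (k div 2))\<^sup>2" by (metis power_Suc power_mult mult.commute)
  also have "\<dots> = ?D * (square_part n * n ^ (k div 2))\<^sup>2"
    by (subst (1) squarefree_decompose[of n]) (simp add: power_mult_distrib mult_ac)
  finally show ?thesis
    using that \<open>?D \<le> B\<close> by (metis gr0I squarefree_part_nonzero)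
qed

text \<open>Dividing by \<open>n ^ y\<close> shows that \<open>n ^ (z - y)\<close> divides
  \<open>B ^ (2 * y)\<close>. The cofactor \<open>m\<close> is a square because it is coprime to
  that power of \<open>n\<close>, and it becomes \<open>V\<^sup>2\<close>.\<close>

lemma equation_reduction:
  fixes A B n x y z :: nat
  assumes pos: "A > 0" "B > 0" "n > 0" and cop: "coprime A B" and xyz: "y < z" "z < x"
    and eq: "(A\<^sup>2 * n) ^ x + (B\<^sup>2 * n) ^ y = ((A\<^sup>2 + B\<^sup>2) * n) ^ z"
  obtains D V W where "0 < D" "D \<le> B" "D * W\<^sup>2 = n ^ (x - z)"
    "V\<^sup>2 + D * (A ^ x * W)\<^sup>2 = (A\<^sup>2 + B\<^sup>2) ^ z"
    "coprime V (A\<^sup>2 + B\<^sup>2)" "coprime (A ^ x * W) (A\<^sup>2 + B\<^sup>2)"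
proof -
  let ?C = "A\<^sup>2 + B\<^sup>2"
  have AC: "coprime A ?C" and BC: "coprime B ?C"
    using coprime_sum_squares[of A B] coprime_sum_squares[of B A] cop
    by (simp_all add: coprime_commute add.commute)
  have "A ^ (2 * x) * n ^ (x - z) * n ^ (z - y) * n ^ y + B ^ (2 * y) * n ^ y =
      ?C ^ z * n ^ (z - y) * n ^ y"
  proof -
    have "n ^ x = n ^ (x - z) * n ^ (z - y) * n ^ y" "n ^ z = n ^ (z - y) * n ^ y"
      using xyz by (simp_all flip: power_add)
    then show ?thesis
      using eq by (simp add: power_mult_distrib mult.assoc flip: power_mult)
  qed
  then have "(A ^ (2 * x) * n ^ (x - z) * n ^ (z - y) + B ^ (2 * y)) * n ^ y = (?C ^ z * n ^ (z - y)) * n ^ y"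
    by (simp add: algebra_simps)
  then have eq1: "A ^ (2 * x) * n ^ (x - z) * n ^ (z - y) + B ^ (2 * y) = ?C ^ z * n ^ (z - y)"
    using pos(3) by simp
  then have "n ^ (z - y) dvd B ^ (2 * y)"
    by (metis dvd_add_right_iff dvd_triv_right)
  then obtain m where m: "B ^ (2 * y) = n ^ (z - y) * m" ..
  have "n ^ (z - y) * (A ^ (2 * x) * n ^ (x - z) + m) = n ^ (z - y) * ?C ^ z"
    using eq1 unfolding m by (simp add: algebra_simps)
  then have eq2: "A ^ (2 * x) * n ^ (x - z) + m = ?C ^ z"
    using pos(3) by simp
  have "coprime (n ^ (z - y) * m) ?C"
    unfolding m[symmetric] using BC by simp
  then have nC: "coprime n ?C" and mC: "coprime m ?C"
    using xyz by simp_all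
  \<comment> \<open>The first summand is divisible by \<open>n\<close> because z < x, while the sum
    is prime to \<open>n\<close>; so \<open>m\<close> is prime to \<open>n\<close>.\<close>
  have "coprime n (A ^ (2 * x) * n ^ (x - z) + m)"
    unfolding eq2 using nC by simp
  moreover have "n dvd A ^ (2 * x) * n ^ (x - z)"
    using xyz by simp
  ultimately have "coprime n m"
    by (meson coprimeI coprime_common_divisor dvd_add dvd_trans)
  then have "coprime (n ^ (z - y)) m" by simp
  moreover have "is_nth_power 2 (n ^ (z - y) * m)"
    unfolding m[symmetric] by (rule is_nth_powerI) (rule power_even_eq)
  moreover have "n ^ (z - y) * m > 0"
    unfolding m[symmetric] using pos(2) by simp
  ultimately have "is_nth_power 2 m"
    using is_nth_power_mult_coprime_natD(2)[of "n ^ (z - y)" m 2] by (simp only: nat_0_less_mult_iff)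
  then obtain V where V: "m = V\<^sup>2" by (rule is_nth_powerE)
  have "p dvd B" if "prime p" "p dvd n" for p
  proof -
    have "p dvd n ^ (z - y)" using that(2) xyz by (simp add: dvd_power_same dvd_trans)
    then show ?thesis
      using \<open>n ^ (z - y) dvd B ^ (2 * y)\<close> that(1) by (meson dvd_trans prime_dvd_power)
  qed
  then obtain D W where D: "n ^ (x - z) = D * W\<^sup>2" "0 < D" "D \<le> B"
    using power_eq_small_times_square[OF pos(3,2)] by blast
  show ?thesis
  proof (rule that[OF D(2,3) D(1)[symmetric]])
    show "V\<^sup>2 + D * (A ^ x * W)\<^sup>2 = ?C ^ z"
      using eq2 unfolding D(1) V by (simp add: power_mult_distrib mult_ac flip: power_mult)
    show "coprime V ?C" using mC by (simp add: V)
    have "coprime (n ^ (x - z)) ?C" using nC by simp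
    then have "coprime W ?C" unfolding D(1) by simp
    then show "coprime (A ^ x * W) ?C" using AC by simp
  qed
qed

text \<open>Division by \<open>A ^ (2 * z)\<close> gives A^2 \<le> (1 + B^2/A^2)^z \<le> exp(z
  B^2/A^2). Taking logarithms, 2 A^2 ln A \<le> z B^2, where one factor \<open>A\<close> is then
  replaced by 8B^3.\<close>

lemma exponent_lower_bound:
  fixes A B C :: nat
  assumes AB: "A > 8 * B ^ 3" "B > 0" and C: "C = A\<^sup>2 + B\<^sup>2" and le: "A ^ (2 * z + 2) \<le> C ^ z"
  shows "real z \<ge> 16 * real A * real B * ln (real A)"
proof -
  have A: "real A > 0" and lnA: "ln (real A) \<ge> 0" using AB by simp_all
  have "real A ^ 2 * (real A ^ 2) ^ z \<le> real C ^ z"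
  proof -
    have "A ^ (2 * z + 2) = A ^ 2 * (A ^ 2) ^ z"
      unfolding power_add power_mult by (rule mult.commute)
    then show ?thesis using le by (metis of_nat_le_iff of_nat_mult of_nat_power)
  qed
  then have "real A ^ 2 \<le> (real C / real A ^ 2) ^ z"
    using A by (simp add: power_divide pos_le_divide_eq)
  also have "real C / real A ^ 2 = 1 + real B ^ 2 / real A ^ 2"
    using A by (simp add: C field_simps)
  also have "\<dots> ^ z \<le> exp (real B ^ 2 / real A ^ 2) ^ z"
    by (intro power_mono exp_ge_add_one_self) simp
  also have "\<dots> = exp (real z * (real B ^ 2 / real A ^ 2))"
    by (rule exp_of_nat_mult[symmetric])
  finally have "ln (real A ^ 2) \<le> real z * (real B ^ 2 / real A ^ 2)"
    using A by (metis exp_gt_zero ln_exp ln_le_cancel_iff zero_less_power)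
  then have 1: "2 * ln (real A) * real A ^ 2 \<le> real z * real B ^ 2"
    using A by (simp add: ln_realpow field_simps)
  have "8 * real B ^ 3 \<le> real A"
    using AB(1) of_nat_le_iff[where 'a = real, of "8 * B ^ 3" A] by simp
  then have "(2 * ln (real A) * real A) * (8 * real B ^ 3) \<le> (2 * ln (real A) * real A) * real A"
    using lnA by (intro mult_left_mono) auto
  then have "(16 * real A * real B * ln (real A)) * real B ^ 2 \<le> real z * real B ^ 2"
    using 1 by (simp add: power2_eq_square power3_eq_cube mult_ac)
  then show ?thesis
    using AB(2) by simp
qed

section \<open>Contradiction between the two bounds on the exponent\<close>

theorem theorem1p1:
  fixes A B n :: nat
  assumes "A > 0" and "B > 0"
    and "min A B > 1"
    and "gcd A B = 1"
    and "[A * B = 0] (mod 2)"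
    and "n > 0" and "n > 1"
    and "A > 8 * B ^ 3"
  shows "\<not> (\<exists>x y z :: nat. x > 0 \<and> y > 0 \<and> z > 0 \<and> x > z \<and> z > y \<and>
            (A\<^sup>2 * n) ^ x + (B\<^sup>2 * n) ^ y = ((A\<^sup>2 + B\<^sup>2) * n) ^ z)"
proof (rule notI, elim exE conjE)
  fix x y z :: nat
  assume z: "z > 0" and xyz: "z < x" "y < z"
    and eq: "(A\<^sup>2 * n) ^ x + (B\<^sup>2 * n) ^ y = ((A\<^sup>2 + B\<^sup>2) * n) ^ z"
  define C where "C = A\<^sup>2 + B\<^sup>2"
  have cop: "coprime A B" using assms(4) by (simp only: coprime_iff_gcd_eq_1)
  have "B > 1" using assms(3) by simp
  then have "(2::nat) ^ 3 \<le> B ^ 3" by (intro power_mono) auto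
  then have A: "A > 64" using assms(8) by simp
  have "B \<le> B ^ 3" using \<open>B > 1\<close> by (intro self_le_power) auto
  then have BA: "B \<le> A" using assms(8) by simp
  have "even (A * B)" using assms(5) by (simp add: cong_0_iff)
  moreover have "\<not> (even A \<and> even B)" using assms(4) by (metis gcd_greatest odd_one)
  ultimately have C_odd: "odd C" by (auto simp: C_def)
  have AC: "coprime C A"
    using coprime_sum_squares[OF cop] by (simp add: C_def coprime_commute)
  obtain D V W where D: "0 < D" "D \<le> B" "D * W\<^sup>2 = n ^ (x - z)"
    and norm: "V\<^sup>2 + D * (A ^ x * W)\<^sup>2 = C ^ z"
    and copVU: "coprime V C" "coprime (A ^ x * W) C"
    unfolding C_def using equation_reduction[OF assms(1,2,6) cop xyz(2,1) eq] .
  have "A ^ (2 * z + 2) \<le> A ^ (2 * x)" using A xyz by (intro power_increasing) auto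
  also have "\<dots> \<le> A ^ (2 * x) * n ^ (x - z)" using assms(6) by simp
  also have "\<dots> = D * (A ^ x * W)\<^sup>2"
    unfolding D(3)[symmetric] by (simp add: power_mult_distrib mult_ac flip: power_mult)
  also have "\<dots> \<le> C ^ z" unfolding norm[symmetric] by simp
  finally have z_large: "real z \<ge> 16 * real A * real B * ln (real A)"
    by (rule exponent_lower_bound[OF assms(8,2) C_def])
  have lnA: "ln (real A) \<ge> 1"
    using A exp_le by (subst ln_ge_iff) auto
  have AB1: "real A \<ge> 1" "real B \<ge> 1" using A \<open>B > 1\<close> by simp_all
  \<comment> \<open>A crude consequence of the lower bound on \<open>z\<close>, enough for
    \<open>3 * D \<le> z\<close>.\<close>
  have "16 * real B \<le> 16 * real B * (real A * ln (real A))"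
    using AB1 lnA mult_mono[of 1 "real A" 1 "ln (real A)"] by (simp add: mult_le_cancel_left1)
  then have "real (3 * D) \<le> real z"
    using z_large D(2) by (simp add: mult_ac)
  then have zD: "3 * D \<le> z" by simp
  interpret primitive_norm_equation D "int (A ^ x * W)" "int V" "int C" z
  proof
    show "(int V)\<^sup>2 + int D * (int (A ^ x * W))\<^sup>2 = int C ^ z"
      using arg_cong[OF norm, of int] by simp
    show "odd (int C)" using C_odd by simp
    have "A\<^sup>2 > 1" using A by (intro one_less_power) auto
    then have "C > 1" by (simp add: C_def)
    then show "int C > 1" by simp
  qed (use D copVU in \<open>simp_all only: coprime_int_iff\<close>)
  have "coprime (int C) (int A)" using AC by simp
  moreover have "int A ^ x dvd int (A ^ x * W)" by simp
  ultimately obtain h q r v where h: "h \<le> 3 * D" "z = h * q" and r: "r \<le> (\<Sum>g | g dvd A. A div g)"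
    and v: "v \<noteq> 0" "v\<^sup>2 \<le> int C ^ (h * r)" "int A ^ x dvd 2 * int q * v"
    using imaginary_part_bound[OF zD assms(1)] by blast
  \<comment> \<open>Here h \<le> 3B and r \<le> 2A ln A, so 2hr \<le> 12 AB ln A, below the lower
    bound 16 AB ln A for \<open>z\<close>.\<close>
  have "real r \<le> real A * (1 + ln (real A))"
    using r sum_divisors_le[OF assms(1)] by (meson of_nat_le_iff order_trans)
  also have "\<dots> \<le> real A * (2 * ln (real A))"
    using lnA by (intro mult_left_mono) auto
  finally have "real h * real r \<le> (3 * real B) * (real A * (2 * ln (real A)))"
    using h(1) D(2) by (intro mult_mono) auto
  also have "2 * \<dots> \<le> 16 * real A * real B * ln (real A)"
    using lnA by (simp add: mult_ac)
  finally have "real (2 * (h * r)) \<le> real z" using z_large by simp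
  then have hr: "2 * (h * r) \<le> z" by (simp only: of_nat_le_iff)
  \<comment> \<open>Fourth powers avoid roots: q \<le> 2^z gives q^4 \<le> 16^z, and v^2 \<le>
    C^(hr) with 2hr \<le> z gives v^4 \<le> C^z \<le> A^(3z).\<close>
  have "q > 0" "h > 0" using z h(2) by (auto intro: Nat.gr0I)
  then have "int q \<le> int z" using h(2) by simp
  also have "int z \<le> 2 ^ z" using less_exp[of z] by (metis less_imp_le of_nat_le_iff of_nat_numeral of_nat_power)
  finally have "int q ^ 4 \<le> (2 ^ z) ^ 4" by (intro power_mono) auto
  also have "(2 ^ z) ^ 4 = (16 :: int) ^ z" by (simp flip: power_mult add: mult.commute[of z] power_mult)
  finally have q4: "int q ^ 4 \<le> 16 ^ z" .
  have "v ^ 4 = (v\<^sup>2)\<^sup>2" by (simp flip: power_mult)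
  also have "\<dots> \<le> (int C ^ (h * r))\<^sup>2" using v(2) by (intro power_mono) auto
  also have "\<dots> = int C ^ (2 * (h * r))" by (simp flip: power_mult add: mult_ac)
  also have "\<dots> \<le> int C ^ z" using hr C_gt_1 by (intro power_increasing) auto
  also have "\<dots> \<le> (int A ^ 3) ^ z"
  proof (intro power_mono)
    have "C \<le> 2 * A\<^sup>2" using power_mono[OF BA, of 2] by (simp add: C_def)
    also have "\<dots> \<le> A * A\<^sup>2" using A by (intro mult_right_mono) auto
    finally have "C \<le> A ^ 3" by (simp add: power3_eq_cube power2_eq_square)
    then show "int C \<le> int A ^ 3" by (metis of_nat_le_iff of_nat_power)
  qed simp
  finally have v4: "v ^ 4 \<le> int A ^ (3 * z)" by (simp add: power_mult)
  \<comment> \<open>The fourth power of this yields A^(4x) \<le> 16^(z+1) A^(3z) < A^(4z+1), as A >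
    16, which is impossible for x > z.\<close>
  have "int A ^ x \<le> \<bar>2 * int q * v\<bar>"
    using dvd_imp_le_int[OF _ v(3)] v(1) \<open>q > 0\<close> by simp
  then have "(int A ^ x) ^ 4 \<le> \<bar>2 * int q * v\<bar> ^ 4"
    by (intro power_mono) auto
  also have "\<dots> = 16 * (int q ^ 4 * v ^ 4)"
    by (simp add: power_mult_distrib power_even_abs)
  also have "\<dots> \<le> 16 * (16 ^ z * int A ^ (3 * z))"
    using q4 v4 by (intro mult_left_mono mult_mono) auto
  also have "\<dots> = 16 ^ Suc z * int A ^ (3 * z)" by simp
  also have "\<dots> < int A ^ Suc z * int A ^ (3 * z)"
    using A by (intro mult_strict_right_mono power_strict_mono) auto
  also have "\<dots> = int A ^ (4 * z + 1)" by (simp flip: power_add)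
  also have "\<dots> \<le> int A ^ (x * 4)" using A xyz by (intro power_increasing) auto
  finally show False by (simp add: power_mult)
qed

end
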